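(* Let $T>0$, $H\geqslant1$, $\lambda_e>0$, $\Omega=\,]-1,1[\,\times\,]0,T[$, and for $u\in C^2(\bar\Omega,\mathbb{R})$ and $(x,t)\in\Omega$ let $\mathscr{F}(u,(x,t))=\partial_tu(x,t)-\partial^2_{x,x}u(x,t)$. Let $E=([-1,1]\times\{0\})\cup(\{-1,1\}\times[0,T])$ and let $h:E\to\mathbb{R}$ be given by $h(-1,t)=h(1,t)=0$ for $t\in[0,T]$ and $$h(x,0)=\tanh^{\circ H}(x+0.5)-\tanh^{\circ H}(x-0.5)+\tanh^{\circ H}(0.5)-\tanh^{\circ H}(1.5),\quad x\in[-1,1].$$ Let $\mu_E$ be a probability distribution on $E$ and let $X^{(e)}\sim\mu_E$. Then, whenever $D\geqslant4$, for any pair $(n_e,n_r)$ of positive integers, all $X^{(e)}_1,\ldots,X^{(e)}_{n_e}\in E$ and all $X^{(r)}_1,\ldots,X^{(r)}_{n_r}\in\Omega$, there exists a minimizing sequence $(u_{\hat\theta(p,n_e,n_r,D)})_{p\in\mathbb{N}}\in\mathrm{NN}_H(D)^{\mathbb{N}}$ of the empirical risk $$R_{n_e,n_r}(u_\theta)=\frac{\lambda_e}{n_e}\sum_{j=1}^{n_e}|u_\theta(X^{(e)}_j)-h(X^{(e)}_j)|^2+\frac1{n_r}\sum_{\ell=1}^{n_r}\mathscr{F}(u_\theta,X^{(r)}_\ell)^2$$ over $\mathrm{NN}_H(D)$ such that $$\lim_{p\to\infty}R_{n_e,n_r}(u_{\hat\theta(p,n_e,n_r,D)})=0\qquad\text{but}\qquad\lim_{p\to\infty}\mathscr{R}(u_{\hat\theta(p,n_e,n_r,D)})=\infty,$$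 where $$\mathscr{R}(u)=\lambda_e\,\mathbb{E}|u(X^{(e)})-h(X^{(e)})|^2+\frac1{|\Omega|}\int_\Omega\mathscr{F}(u,\mathbf{x})^2\,d\mathbf{x}.$$ So this estimator is not risk-consistent.
   Context: $\tanh^{\circ 1}=\tanh$ and $\tanh^{\circ(k+1)}=\tanh\circ\tanh^{\circ k}$. $|\Omega|$ is the Lebesgue measure of $\Omega$. Neural networks. For $H\geqslant1$ hidden layers of common width $D\geqslant 1$, and input/output dimensions $d_1,d_2$ (here $d_1=2$, $d_2=1$), $u_\theta=\mathcal{A}_{H+1}\circ(\tanh\circ\mathcal{A}_H)\circ\cdots\circ(\tanh\circ\mathcal{A}_1)$, where $\tanh$ is applied element-wise, $\mathcal{A}_k(x)=W_kx+b_k$ with $W_k\in\mathbb{R}^{L_k\times L_{k-1}}$, $b_k\in\mathbb{R}^{L_k}$, $L_0=d_1$, $L_1=\cdots=L_H=D$, $L_{H+1}=d_2$. The parameter is $\theta=(W_1,b_1,\ldots,W_{H+1},b_{H+1})$, $\Theta_{H,D}$ is the set of all such parameters, and $\mathrm{NN}_H(D)=\{u_\theta:\theta\in\Theta_{H,D}\}$. A minimizing sequence of $R_{n_e,n_r}$ over $\mathrm{NN}_H(D)$ is a sequence whose risks converge to $\inf_{\theta\in\Theta_{H,D}}R_{n_e,n_r}(u_\theta)$. A minimizing sequence of the empirical risk is called risk-consistent if $\lim_{n_e,n_r\to\infty}\lim_{p\to\infty}\mathscr{R}(u_{\hat\theta(p,n_e,n_r,D)})=\inf_{u\in\mathrm{NN}_H(D)}\mathscr{R}(u)$.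 *)

theory Defs
  imports "HOL-Probability.Probability" "Jordan_Normal_Form.Matrix"
begin

section \<open>Neural networks\<close>

text \<open>
  A parameter is the list of the pairs of a weight matrix and a bias vector,
  starting with the layer that is applied first. The width and the depth are
  natural numbers, hence the carrier-based matrices of \<^theory>\<open>Jordan_Normal_Form.Matrix\<close>.
\<close>

type_synonym nn_param = "(real mat \<times> real Matrix.vec) list"

definition layer_dim :: "nat \<Rightarrow> nat \<Rightarrow> nat \<Rightarrow> nat \<Rightarrow> nat \<Rightarrow> nat" where
  "layer_dim d1 d2 H D k = (if k = 0 then d1 else if k \<le> H then D else d2)"

definition nn_params :: "nat \<Rightarrow> nat \<Rightarrow> nat \<Rightarrow> nat \<Rightarrow> nn_param set" where
  "nn_params d1 d2 H D =
     {\<theta>. length \<theta> = H + 1 \<and>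
        (\<forall>k\<le>H. fst (\<theta> ! k) \<in> carrier_mat (layer_dim d1 d2 H D (k + 1)) (layer_dim d1 d2 H D k) \<and>
               snd (\<theta> ! k) \<in> carrier_vec (layer_dim d1 d2 H D (k + 1)))}"

definition affine_layer :: "real mat \<times> real Matrix.vec \<Rightarrow> real Matrix.vec \<Rightarrow> real Matrix.vec" where
  "affine_layer A x = fst A *\<^sub>v x + snd A"

text \<open>The activation is applied after every affine map except the last one.\<close>

fun nn_eval :: "nn_param \<Rightarrow> real Matrix.vec \<Rightarrow> real Matrix.vec" where
  "nn_eval [] x = x"
| "nn_eval [A] x = affine_layer A x"
| "nn_eval (A # B # \<theta>) x = nn_eval (B # \<theta>) (map_vec tanh (affine_layer A x))"

abbreviation Theta :: "nat \<Rightarrow> nat \<Rightarrow> nn_param set" where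
  "Theta H D \<equiv> nn_params 2 1 H D"

definition nn :: "nn_param \<Rightarrow> real \<times> real \<Rightarrow> real" where
  "nn \<theta> = (\<lambda>(x, t). vec_index (nn_eval \<theta> (vec_of_list [x, t])) 0)"

definition NN :: "nat \<Rightarrow> nat \<Rightarrow> (real \<times> real \<Rightarrow> real) set" where
  "NN H D = nn ` Theta H D"


section \<open>The heat equation and the risks\<close>

definition Omega :: "real \<Rightarrow> (real \<times> real) set" where
  "Omega T = {-1<..<1} \<times> {0<..<T}"

definition Ebd :: "real \<Rightarrow> (real \<times> real) set" where
  "Ebd T = ({-1..1} \<times> {0}) \<union> ({-1, 1} \<times> {0..T})"

text \<open>
  The partial derivatives are total functions here; they are only meaningful for
  sufficiently smooth functions, which all elements of \<^const>\<open>NN\<close> are.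
\<close>

definition heat_op :: "(real \<times> real \<Rightarrow> real) \<Rightarrow> real \<times> real \<Rightarrow> real" where
  "heat_op u = (\<lambda>(x, t). deriv (\<lambda>s. u (x, s)) t - deriv (deriv (\<lambda>y. u (y, t))) x)"

definition emp_risk ::
  "real \<Rightarrow> (real \<times> real \<Rightarrow> real) \<Rightarrow> nat \<Rightarrow> nat \<Rightarrow> (nat \<Rightarrow> real \<times> real) \<Rightarrow> (nat \<Rightarrow> real \<times> real) \<Rightarrow>
   (real \<times> real \<Rightarrow> real) \<Rightarrow> real" where
  "emp_risk lam h ne nr Xe Xr u =
     lam / real ne * (\<Sum>j=1..ne. \<bar>u (Xe j) - h (Xe j)\<bar>\<^sup>2) +
     1 / real nr * (\<Sum>l=1..nr. (heat_op u (Xr l))\<^sup>2)"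

text \<open>
  In the following definition, \<open>X\<close> is a random variable on the probability space \<open>M\<close>. For networks \<open>u\<close>
  both integrands are bounded and measurable, so that no Bochner integral is taken of a
  non-integrable function.
\<close>

definition risk ::
  "real \<Rightarrow> real \<Rightarrow> (real \<times> real \<Rightarrow> real) \<Rightarrow> 'w measure \<Rightarrow> ('w \<Rightarrow> real \<times> real) \<Rightarrow>
   (real \<times> real \<Rightarrow> real) \<Rightarrow> real" where
  "risk lam T h M X u =
     lam * prob_space.expectation M (\<lambda>\<omega>. \<bar>u (X \<omega>) - h (X \<omega>)\<bar>\<^sup>2) +
     1 / measure lborel (Omega T) * (LINT z:Omega T|lborel. (heat_op u z)\<^sup>2)"

definition minimizing_seq ::
  "((real \<times> real \<Rightarrow> real) \<Rightarrow> real) \<Rightarrow> nat \<Rightarrow> nat \<Rightarrow> (nat \<Rightarrow> nn_param) \<Rightarrow> bool" where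
  "minimizing_seq R H D \<theta> \<longleftrightarrow>
     (\<forall>p. \<theta> p \<in> Theta H D) \<and> (\<lambda>p. R (nn (\<theta> p))) \<longlonglongrightarrow> (INF \<theta>\<in>Theta H D. R (nn \<theta>))"

text \<open>
  The inner limit is taken in the extended reals, where it may be infinite; the outer limit is
  the joint limit in the two sample sizes.
\<close>

definition risk_consistent ::
  "((real \<times> real \<Rightarrow> real) \<Rightarrow> real) \<Rightarrow> nat \<Rightarrow> nat \<Rightarrow> (nat \<Rightarrow> nat \<Rightarrow> nat \<Rightarrow> nn_param) \<Rightarrow> bool" where
  "risk_consistent R H D \<theta> \<longleftrightarrow>
     (\<exists>L :: nat \<Rightarrow> nat \<Rightarrow> ereal.
        (\<forall>ne>0. \<forall>nr>0. (\<lambda>p. ereal (R (nn (\<theta> p ne nr)))) \<longlonglongrightarrow> L ne nr) \<and>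
        ((\<lambda>(ne, nr). L ne nr) \<longlongrightarrow> ereal (INF u\<in>NN H D. R u)) (sequentially \<times>\<^sub>F sequentially))"

end

theory Submission
  imports Defs "HOL-Real_Asymp.Real_Asymp"
begin

text \<open>
  Write \<open>f\<close> for the \<open>H\<close>-fold iterate of \<open>tanh\<close>. The initial profile is itself a combination of
  shifts of \<open>f\<close>, and the counterexample lets this profile travel with a large speed \<open>p\<close>:
  \<open>u\<^sub>p (x, t) = f (x + 0.5 + p t) - f (x - 0.5 + p t) + f (0.5 + p t) - f (1.5 + p t)\<close>.
  A network with four active neurons per layer computes it exactly (\<open>nn_wave_param\<close>): the first
  layer forms the four arguments, the intermediate layers carry identity matrices, and the last
  layer takes the alternating sum.

  At \<open>t = 0\<close> the function \<open>u\<^sub>p\<close> fits \<open>h\<close> for every speed. At a fixed time \<open>t > 0\<close> all four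
  arguments run into the plateau of \<open>f\<close> as \<open>p\<close> grows, where \<open>f\<close> is constant up to an exponentially
  small error. So \<open>u\<^sub>p\<close> and its heat residual tend to \<open>0\<close> there, the factor \<open>p\<close> in the time
  derivative notwithstanding. Finitely many sample points see nothing else, hence the empirical
  risk tends to \<open>0\<close> (\<open>emp_risk_wave_tendsto_0\<close>), and as risks are nonnegative this is its infimum.

  The whole transition takes place in a time layer of thickness of order \<open>1 / p\<close>. In it the time
  derivative has size of order \<open>p\<close>, whereas the second space derivative is bounded uniformly in \<open>p\<close>.
  The squared residual, of order \<open>p\<^sup>2\<close> on a set of measure of order \<open>1 / p\<close>, therefore has an
  integral that grows at least linearly in \<open>p\<close> (\<open>heat_energy_wave_at_top\<close>), and the risk diverges.

  Risk consistency fails because all inner limits are \<open>\<infinity>\<close>, while the infimum of the risk is a real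
  number.
\<close>

section \<open>Iterated hyperbolic tangents\<close>

fun tanh_iter_deriv :: "nat \<Rightarrow> real \<Rightarrow> real" where
  "tanh_iter_deriv 0 x = 1"
| "tanh_iter_deriv (Suc k) x = (1 - ((tanh ^^ Suc k) x)\<^sup>2) * tanh_iter_deriv k x"

fun tanh_iter_deriv2 :: "nat \<Rightarrow> real \<Rightarrow> real" where
  "tanh_iter_deriv2 0 x = 0"
| "tanh_iter_deriv2 (Suc k) x =
     - 2 * (tanh ^^ Suc k) x * tanh_iter_deriv (Suc k) x * tanh_iter_deriv k x +
     (1 - ((tanh ^^ Suc k) x)\<^sup>2) * tanh_iter_deriv2 k x"

lemma has_field_derivative_tanh_iter:
  fixes x :: real
  shows "((tanh ^^ k) has_field_derivative tanh_iter_deriv k x) (at x)"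
proof (induction k)
  case (Suc k)
  have "((\<lambda>y. tanh ((tanh ^^ k) y)) has_field_derivative
      (1 - (tanh ((tanh ^^ k) x))\<^sup>2) * tanh_iter_deriv k x) (at x)"
    by (rule derivative_eq_intros Suc refl | simp)+
  then show ?case by (simp add: o_def)
qed (simp add: id_def)

lemma has_field_derivative_tanh_iter_deriv:
  "(tanh_iter_deriv k has_field_derivative tanh_iter_deriv2 k x) (at x)"
proof (induction k)
  case 0
  then show ?case by (simp add: fun_eq_iff [of "tanh_iter_deriv 0" "\<lambda>_. 1"])
next
  case (Suc k)
  have "((\<lambda>y. (1 - ((tanh ^^ Suc k) y)\<^sup>2) * tanh_iter_deriv k y) has_field_derivative
      tanh_iter_deriv2 (Suc k) x) (at x)"
    by (rule derivative_eq_intros has_field_derivative_tanh_iter Suc refl | simp add: algebra_simps)+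
  then show ?case by (simp add: fun_eq_iff [of "tanh_iter_deriv (Suc k)"])
qed

lemmas has_field_derivative_tanh_iter_chain [derivative_intros] =
  DERIV_chain2 [OF has_field_derivative_tanh_iter]
  DERIV_chain2 [OF has_field_derivative_tanh_iter_deriv]

lemma continuous_on_tanh_iter: "continuous_on A (tanh ^^ k :: real \<Rightarrow> real)"
  using has_field_derivative_tanh_iter by (meson DERIV_isCont continuous_at_imp_continuous_on)

lemma continuous_on_tanh_iter_deriv: "continuous_on A (tanh_iter_deriv k)"
  using has_field_derivative_tanh_iter_deriv by (meson DERIV_isCont continuous_at_imp_continuous_on)

lemma continuous_on_tanh_iter_deriv2: "continuous_on A (tanh_iter_deriv2 k)"
proof (induction k)
  case 0
  then show ?case by simp
next
  case (Suc k)
  show ?case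
    unfolding tanh_iter_deriv2.simps
    by (intro continuous_intros continuous_on_tanh_iter continuous_on_tanh_iter_deriv Suc)
qed

lemmas continuous_on_tanh_iter_compose [continuous_intros] =
  continuous_on_compose2 [OF continuous_on_tanh_iter [of UNIV] _ subset_UNIV]
  continuous_on_compose2 [OF continuous_on_tanh_iter_deriv [of UNIV] _ subset_UNIV]
  continuous_on_compose2 [OF continuous_on_tanh_iter_deriv2 [of UNIV] _ subset_UNIV]

lemma tanh_square_less_1: "(tanh (x :: real))\<^sup>2 < 1"
  using tanh_real_bounds [of x] by (auto simp: abs_square_less_1 abs_less_iff)

lemma tanh_iter_deriv_pos: "0 < tanh_iter_deriv k x"
  by (induction k) (use tanh_square_less_1 in \<open>auto simp: o_def\<close>)

lemma tanh_iter_deriv_le_1: "tanh_iter_deriv k x \<le> 1"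
proof (induction k)
  case (Suc k)
  have "(1 - ((tanh ^^ Suc k) x)\<^sup>2) * tanh_iter_deriv k x \<le> 1 * 1"
    using Suc tanh_iter_deriv_pos [of k x] by (intro mult_mono) auto
  then show ?case by simp
qed simp

text \<open>
  By the chain rule the derivative is a product of factors from \<open>]0, 1]\<close>, the innermost of which is
  \<open>1 - tanh\<^sup>2\<close>; so every iterate inherits the exponential decay of the derivative of \<open>tanh\<close>.
\<close>

lemma tanh_iter_deriv_le: "tanh_iter_deriv (Suc k) x \<le> 1 - (tanh x)\<^sup>2"
proof (induction k)
  case (Suc k)
  have "tanh_iter_deriv (Suc (Suc k)) x \<le> 1 * tanh_iter_deriv (Suc k) x"
    unfolding tanh_iter_deriv.simps(2) [of "Suc k"]
    using tanh_iter_deriv_pos [of "Suc k" x] by (intro mult_right_mono) auto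
  with Suc show ?case by linarith
qed simp

text \<open>
  One more layer adds a term with the factor \<open>tanh_iter_deriv (Suc k)\<close>, which already decays like
  the derivative of \<open>tanh\<close>, and multiplies the old second derivative by a number in \<open>[0, 1]\<close>; hence
  a constant that is linear in the number of layers.
\<close>

lemma abs_tanh_iter_deriv2_le: "\<bar>tanh_iter_deriv2 k x\<bar> \<le> 2 * real k * (1 - (tanh x)\<^sup>2)"
proof (induction k)
  case (Suc k)
  define a where "a = (tanh ^^ Suc k) x"
  have a: "\<bar>a\<bar> \<le> 1" "\<bar>1 - a\<^sup>2\<bar> \<le> 1"
    using tanh_real_bounds [of "(tanh ^^ k) x"] tanh_square_less_1 [of "(tanh ^^ k) x"]
    by (auto simp: a_def)
  have d: "\<bar>tanh_iter_deriv (Suc k) x\<bar> \<le> 1 - (tanh x)\<^sup>2" "\<bar>tanh_iter_deriv k x\<bar> \<le> 1"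
    using tanh_iter_deriv_pos [of "Suc k" x] tanh_iter_deriv_le [of k x]
      tanh_iter_deriv_pos [of k x] tanh_iter_deriv_le_1 [of k x] by linarith+
  have "\<bar>a\<bar> * \<bar>tanh_iter_deriv (Suc k) x\<bar> * \<bar>tanh_iter_deriv k x\<bar> \<le> 1 * (1 - (tanh x)\<^sup>2) * 1"
    using a d by (intro mult_mono) auto
  moreover have "\<bar>1 - a\<^sup>2\<bar> * \<bar>tanh_iter_deriv2 k x\<bar> \<le> 1 * (2 * real k * (1 - (tanh x)\<^sup>2))"
    using a Suc by (intro mult_mono) auto
  moreover have "\<bar>tanh_iter_deriv2 (Suc k) x\<bar> \<le>
      2 * (\<bar>a\<bar> * \<bar>tanh_iter_deriv (Suc k) x\<bar> * \<bar>tanh_iter_deriv k x\<bar>) + \<bar>1 - a\<^sup>2\<bar> * \<bar>tanh_iter_deriv2 k x\<bar>"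
    unfolding tanh_iter_deriv2.simps a_def [symmetric]
    by (rule order_trans [OF abs_triangle_ineq]) (simp add: abs_mult)
  ultimately show ?case by (simp add: algebra_simps)
qed simp

lemma abs_tanh_iter_deriv2_bounded: "\<bar>tanh_iter_deriv2 k x\<bar> \<le> 2 * real k"
proof -
  have "2 * real k * (1 - (tanh x)\<^sup>2) \<le> 2 * real k * 1"
    by (intro mult_left_mono) auto
  then show ?thesis using abs_tanh_iter_deriv2_le [of k x] by linarith
qed

lemma tanh_iter_minus: "(tanh ^^ k) (- x) = - (tanh ^^ k) (x :: real)"
  by (induction k) auto

lemma tanh_iter_deriv_minus: "tanh_iter_deriv k (- x) = tanh_iter_deriv k x"
  by (induction k) (auto simp: tanh_iter_minus simp del: funpow.simps)

lemma tanh_iter_nonneg: "0 \<le> (x :: real) \<Longrightarrow> 0 \<le> (tanh ^^ k) x"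
  by (induction k) auto

lemma tanh_iter_strict_mono: "x < y \<Longrightarrow> (tanh ^^ k) x < (tanh ^^ k) (y :: real)"
  by (induction k) auto

text \<open>
  On the positive half line each iterate increases and so each factor of the derivative decreases.
  The case of no iteration, where the derivative is constant, makes the weak inequality a separate
  claim, which the induction for the strict one needs.
\<close>

lemma tanh_iter_deriv_antimono:
  assumes "0 \<le> x" "x < y"
  shows "tanh_iter_deriv k y \<le> tanh_iter_deriv k x"
    and "k > 0 \<Longrightarrow> tanh_iter_deriv k y < tanh_iter_deriv k x"
proof (induction k)
  case (Suc k)
  have "((tanh ^^ Suc k) x)\<^sup>2 < ((tanh ^^ Suc k) y)\<^sup>2"
    using tanh_iter_strict_mono [OF assms(2)] tanh_iter_nonneg [OF assms(1)]
    by (intro power_strict_mono) (auto simp del: funpow.simps)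
  moreover have "((tanh ^^ Suc k) y)\<^sup>2 < 1"
    by (simp add: tanh_square_less_1)
  ultimately have "tanh_iter_deriv (Suc k) y < tanh_iter_deriv (Suc k) x"
    unfolding tanh_iter_deriv.simps
    using Suc(1) tanh_iter_deriv_pos [of k y]
    by (intro mult_less_le_imp_less) auto
  then show "tanh_iter_deriv (Suc k) y \<le> tanh_iter_deriv (Suc k) x"
    and "tanh_iter_deriv (Suc k) y < tanh_iter_deriv (Suc k) x" by simp_all
qed auto

text \<open>
  The decay is exponential, hence it beats the factor \<open>p\<close> that the time derivative of a wave of
  speed \<open>p\<close> carries.
\<close>

lemma tanh_decay:
  assumes "t > 0"
  shows "((\<lambda>p. p * (1 - (tanh (a + p * t))\<^sup>2)) \<longlongrightarrow> (0 :: real)) at_top"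
    and "((\<lambda>p. 1 - (tanh (a + p * t))\<^sup>2) \<longlongrightarrow> (0 :: real)) at_top"
  unfolding tanh_real_altdef using assms by real_asymp+

lemma tanh_iter_deriv_decay:
  assumes "t > 0" "k > 0"
  shows "((\<lambda>p. p * tanh_iter_deriv k (a + p * t)) \<longlongrightarrow> 0) at_top"
proof (rule Lim_null_comparison [OF _ tanh_decay(1) [OF assms(1)]])
  obtain m where m: "k = Suc m" using assms(2) gr0_implies_Suc by blast
  have "norm (p * tanh_iter_deriv k (a + p * t)) \<le> p * (1 - (tanh (a + p * t))\<^sup>2)" if "p \<ge> 0" for p
    using that tanh_iter_deriv_le [of m "a + p * t"] tanh_iter_deriv_pos [of k "a + p * t"]
    by (auto simp: m abs_mult simp del: tanh_iter_deriv.simps intro!: mult_left_mono)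
  then show "\<forall>\<^sub>F p in at_top. norm (p * tanh_iter_deriv k (a + p * t)) \<le> p * (1 - (tanh (a + p * t))\<^sup>2)"
    by (intro eventually_mono [OF eventually_ge_at_top [of 0]])
qed

lemma tanh_iter_deriv2_decay:
  assumes "t > 0"
  shows "((\<lambda>p. tanh_iter_deriv2 k (a + p * t)) \<longlongrightarrow> 0) at_top"
proof (rule Lim_null_comparison)
  show "\<forall>\<^sub>F p in at_top. norm (tanh_iter_deriv2 k (a + p * t)) \<le> 2 * real k * (1 - (tanh (a + p * t))\<^sup>2)"
    by (simp add: abs_tanh_iter_deriv2_le)
  show "((\<lambda>p. 2 * real k * (1 - (tanh (a + p * t))\<^sup>2)) \<longlongrightarrow> 0) at_top"
    by (rule tendsto_mult_right_zero [OF tanh_decay(2) [OF assms]])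
qed

text \<open>An iterate tends to a finite limit, so its increments over a shift of fixed length vanish.\<close>

lemma tanh_iter_tendsto_at_top:
  obtains l :: real where "((tanh ^^ Suc k) \<longlongrightarrow> l) at_top"
proof -
  have "\<exists>l :: real. ((tanh ^^ Suc k) \<longlongrightarrow> l) at_top"
  proof (induction k)
    case 0
    have "(tanh \<longlongrightarrow> (1 :: real)) at_top" by (rule tanh_real_at_top)
    then show ?case by auto
  next
    case (Suc k)
    then obtain l :: real where "((tanh ^^ Suc k) \<longlongrightarrow> l) at_top" by blast
    then have "((\<lambda>x. tanh ((tanh ^^ Suc k) x)) \<longlongrightarrow> tanh l) at_top"
      by (rule tendsto_tanh) simp
    moreover have "(\<lambda>x :: real. tanh ((tanh ^^ Suc k) x)) = tanh ^^ Suc (Suc k)"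
      by (simp add: fun_eq_iff)
    ultimately show ?case by metis
  qed
  with that show thesis by blast
qed

section \<open>The travelling wave\<close>

definition wave :: "nat \<Rightarrow> real \<Rightarrow> real \<times> real \<Rightarrow> real" where
  "wave k p = (\<lambda>(x, t). (tanh ^^ k) (x + 0.5 + p * t) - (tanh ^^ k) (x - 0.5 + p * t) +
     (tanh ^^ k) (0.5 + p * t) - (tanh ^^ k) (1.5 + p * t))"

text \<open>
  The time derivative of the wave is \<open>p\<close> times this function at \<open>(x, p * t)\<close>. The rescaled time
  \<open>s = p * t\<close> makes it independent of the speed, so one lower bound serves for all \<open>p\<close>.
\<close>

definition wave_slope :: "nat \<Rightarrow> real \<times> real \<Rightarrow> real" where
  "wave_slope k = (\<lambda>(x, s). tanh_iter_deriv k (x + 0.5 + s) - tanh_iter_deriv k (x - 0.5 + s) +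
     tanh_iter_deriv k (0.5 + s) - tanh_iter_deriv k (1.5 + s))"

lemma heat_op_wave:
  "heat_op (wave k p) (x, t) = p * wave_slope k (x, p * t) -
     (tanh_iter_deriv2 k (x + 0.5 + p * t) - tanh_iter_deriv2 k (x - 0.5 + p * t))"
proof -
  have t: "((\<lambda>s. wave k p (x, s)) has_field_derivative p * wave_slope k (x, p * t)) (at t)"
    unfolding wave_def wave_slope_def prod.case
    by (rule derivative_eq_intros refl)+ (simp add: algebra_simps)
  have x: "((\<lambda>y. wave k p (y, t)) has_field_derivative
      tanh_iter_deriv k (y + 0.5 + p * t) - tanh_iter_deriv k (y - 0.5 + p * t)) (at y)" for y
    unfolding wave_def prod.case
    by (rule derivative_eq_intros refl)+ simp
  have "deriv (\<lambda>y. wave k p (y, t)) =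
      (\<lambda>y. tanh_iter_deriv k (y + 0.5 + p * t) - tanh_iter_deriv k (y - 0.5 + p * t))"
    using DERIV_imp_deriv [OF x] by blast
  moreover have "((\<lambda>y. tanh_iter_deriv k (y + 0.5 + p * t) - tanh_iter_deriv k (y - 0.5 + p * t))
      has_field_derivative
      tanh_iter_deriv2 k (x + 0.5 + p * t) - tanh_iter_deriv2 k (x - 0.5 + p * t)) (at x)"
    by (rule derivative_eq_intros refl)+ simp
  ultimately show ?thesis
    using DERIV_imp_deriv [OF t] by (simp add: heat_op_def DERIV_imp_deriv)
qed

lemma continuous_on_wave_slope: "continuous_on A (wave_slope k)"
  unfolding wave_slope_def case_prod_beta by (intro continuous_intros)

lemma continuous_on_heat_op_wave: "continuous_on A (heat_op (wave k p))"
proof -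
  have "heat_op (wave k p) = (\<lambda>z. p * wave_slope k (fst z, p * snd z) -
     (tanh_iter_deriv2 k (fst z + 0.5 + p * snd z) - tanh_iter_deriv2 k (fst z - 0.5 + p * snd z)))"
    by (auto simp: heat_op_wave)
  then show ?thesis
    by (auto intro!: continuous_intros continuous_on_compose2 [OF continuous_on_wave_slope [of UNIV]])
qed

lemma wave_initial: "wave k p (x, 0) =
    (tanh ^^ k) (x + 0.5) - (tanh ^^ k) (x - 0.5) + (tanh ^^ k) 0.5 - (tanh ^^ k) 1.5"
  by (simp add: wave_def)

text \<open>The two positive and the two negative terms reach the same plateau and cancel.\<close>

lemma wave_tendsto_0:
  assumes "t > 0" "k > 0"
  shows "((\<lambda>p. wave k p (x, t)) \<longlongrightarrow> 0) at_top"
proof -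
  obtain m where m: "k = Suc m" using assms(2) gr0_implies_Suc by blast
  obtain l :: real where l: "((tanh ^^ k) \<longlongrightarrow> l) at_top"
    using tanh_iter_tendsto_at_top m by blast
  have "filterlim (\<lambda>p. a + p * t) at_top at_top" for a
    using assms(1) by real_asymp
  then have "((\<lambda>p. (tanh ^^ k) (a + p * t)) \<longlongrightarrow> l) at_top" for a
    by (rule filterlim_compose [OF l])
  then have "((\<lambda>p. wave k p (x, t)) \<longlongrightarrow> l - l + l - l) at_top"
    unfolding wave_def prod.case by (intro tendsto_intros)
  then show ?thesis by simp
qed

lemma heat_op_wave_tendsto_0:
  assumes "t > 0" "k > 0"
  shows "((\<lambda>p. heat_op (wave k p) (x, t)) \<longlongrightarrow> 0) at_top"
proof -
  note d = tanh_iter_deriv_decay [OF assms] and d2 = tanh_iter_deriv2_decay [OF assms(1), of k]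
  have "((\<lambda>p. p * tanh_iter_deriv k (x + 0.5 + p * t) - p * tanh_iter_deriv k (x - 0.5 + p * t) +
      p * tanh_iter_deriv k (0.5 + p * t) - p * tanh_iter_deriv k (1.5 + p * t) -
      (tanh_iter_deriv2 k (x + 0.5 + p * t) - tanh_iter_deriv2 k (x - 0.5 + p * t)))
      \<longlongrightarrow> 0 - 0 + 0 - 0 - (0 - 0)) at_top"
    by (intro tendsto_intros d d2)
  then show ?thesis
    by (simp add: heat_op_wave wave_slope_def algebra_simps)
qed

section \<open>The two risks of the travelling wave\<close>

text \<open>
  The corners, which belong to both parts of the boundary, are treated as initial points, where the
  fit is exact; at lateral points with \<open>t > 0\<close> the wave has passed.
\<close>

lemma wave_boundary_tendsto:
  assumes "k > 0" "z \<in> Ebd T"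
    and h_lateral: "\<And>t. t \<in> {0..T} \<Longrightarrow> h (-1, t) = 0 \<and> h (1, t) = 0"
    and h_initial: "\<And>x. x \<in> {-1..1} \<Longrightarrow>
      h (x, 0) = (tanh ^^ k) (x + 0.5) - (tanh ^^ k) (x - 0.5) + (tanh ^^ k) 0.5 - (tanh ^^ k) 1.5"
  shows "((\<lambda>p. wave k p z - h z) \<longlongrightarrow> 0) at_top"
proof -
  obtain x t where z: "z = (x, t)" by force
  consider "t = 0" "x \<in> {-1..1}" | "t > 0" "x \<in> {-1, 1}" "t \<in> {0..T}"
    using assms(2) by (fastforce simp: z Ebd_def)
  then show ?thesis
  proof cases
    case 1
    then show ?thesis using h_initial [of x] by (simp add: z wave_initial)
  next
    case 2
    then have "h z = 0" using h_lateral [of t] by (auto simp: z)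
    then show ?thesis using wave_tendsto_0 [OF 2(1) assms(1)] by (simp add: z)
  qed
qed

lemma emp_risk_wave_tendsto_0:
  assumes "k > 0"
    and "\<And>t. t \<in> {0..T} \<Longrightarrow> h (-1, t) = 0 \<and> h (1, t) = 0"
    and "\<And>x. x \<in> {-1..1} \<Longrightarrow>
      h (x, 0) = (tanh ^^ k) (x + 0.5) - (tanh ^^ k) (x - 0.5) + (tanh ^^ k) 0.5 - (tanh ^^ k) 1.5"
    and Xe: "\<forall>j\<in>{1..ne}. Xe j \<in> Ebd T" and Xr: "\<forall>l\<in>{1..nr}. Xr l \<in> Omega T"
  shows "((\<lambda>p. emp_risk lam h ne nr Xe Xr (wave k p)) \<longlongrightarrow> 0) at_top"
proof -
  have e: "((\<lambda>p. wave k p (Xe j) - h (Xe j)) \<longlongrightarrow> 0) at_top" if "j \<in> {1..ne}" for j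
    using Xe that by (intro wave_boundary_tendsto [where T = T]) (use assms in auto)
  have r: "((\<lambda>p. heat_op (wave k p) (Xr l)) \<longlongrightarrow> 0) at_top" if "l \<in> {1..nr}" for l
    using Xr that heat_op_wave_tendsto_0 [OF _ assms(1), of "snd (Xr l)" "fst (Xr l)"]
    by (force simp: Omega_def)
  have "((\<lambda>p. emp_risk lam h ne nr Xe Xr (wave k p)) \<longlongrightarrow>
      lam / real ne * (\<Sum>j=1..ne. \<bar>0\<bar>\<^sup>2) + 1 / real nr * (\<Sum>l=1..nr. 0\<^sup>2)) at_top"
    unfolding emp_risk_def by (intro tendsto_intros e r)
  then show ?thesis by simp
qed

text \<open>
  The derivative \<open>f'\<close> of the iterate is even, so the first two terms cancel at \<open>x = 0\<close> and
  \<open>f' (0.5) - f' (1.5)\<close> remains.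
\<close>

lemma wave_slope_pos: "k > 0 \<Longrightarrow> wave_slope k (0, 0) > 0"
  using tanh_iter_deriv_antimono(2) [of "0.5" "1.5" k] tanh_iter_deriv_minus [of k "0.5"]
  by (simp add: wave_slope_def)

lemma wave_slope_lower_bound:
  assumes "k > 0"
  obtains c d where "c > 0" "d > 0" "\<And>x s. \<bar>x\<bar> < d \<Longrightarrow> \<bar>s\<bar> < d \<Longrightarrow> c \<le> wave_slope k (x, s)"
proof -
  define c where "c = wave_slope k (0, 0) / 2"
  have c: "c > 0" using wave_slope_pos [OF assms] by (simp add: c_def)
  have "continuous (at (0, 0)) (wave_slope k)"
    using continuous_on_wave_slope [of UNIV] by (simp add: continuous_on_eq_continuous_within)
  then obtain d where d: "d > 0" "\<And>z. dist z (0, 0) < d \<Longrightarrow> dist (wave_slope k z) (wave_slope k (0, 0)) < c"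
    using c unfolding continuous_at_eps_delta by meson
  show ?thesis
  proof
    show "c > 0" "d / 2 > 0" using c d by auto
    fix x s :: real
    assume "\<bar>x\<bar> < d / 2" "\<bar>s\<bar> < d / 2"
    then have "dist (x, s) (0, 0) < d"
      using sqrt_sum_squares_le_sum_abs [of x s] by (simp add: dist_Pair_Pair)
    then show "c \<le> wave_slope k (x, s)"
      using d(2) [of "(x, s)"] unfolding dist_real_def c_def by linarith
  qed
qed

lemma set_integrable_heat_op_wave_sq:
  "set_integrable lborel (Omega T) (\<lambda>z. (heat_op (wave k p) z)\<^sup>2)"
proof (rule set_integrable_subset)
  show "set_integrable lborel (cbox (-1, 0) (1, T)) (\<lambda>z. (heat_op (wave k p) z)\<^sup>2)"
    unfolding set_integrable_def
    by (rule borel_integrable_compact)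
       (auto intro!: continuous_intros continuous_on_heat_op_wave)
qed (auto simp: Omega_def cbox_Pair_eq intro!: borel_open open_Times)

lemma measure_open_rectangle:
  assumes "a \<le> b" "c \<le> d"
  shows "measure lborel ({a<..<b} \<times> {c<..<(d :: real)}) = (b - a) * (d - (c :: real))"
proof -
  have "{a<..<b} \<times> {c<..<d} = box (a, c) (b, d)" by (simp add: box_prod box_real)
  moreover have "measure lborel (box (a, c) (b, d)) = measure lborel (cbox (a, c) (b, d))"
    by (simp add: measure_lborel_box_eq measure_lborel_cbox_eq)
  ultimately show ?thesis using assms by (simp add: content_Pair)
qed

text \<open>
  Only the rectangle \<open>S\<close> of half-width \<open>d\<close> around \<open>x = 0\<close> and of height \<open>d / p\<close> in time is used. There
  the rescaled time stays below \<open>d\<close>, the slope is at least \<open>c\<close>, and once \<open>p\<close> is so large that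
  \<open>p * c / 2\<close> exceeds the bound \<open>4 * k\<close> on the two second derivatives, the residual is at least
  \<open>p * c / 2\<close>. Multiplying its square by the measure \<open>2 * d\<^sup>2 / p\<close> gives a linear lower bound.
\<close>

lemma heat_energy_wave_at_top:
  assumes T: "T > 0" and k: "k > 0"
  shows "filterlim (\<lambda>p. LINT z:Omega T|lborel. (heat_op (wave k p) z)\<^sup>2) at_top at_top"
proof -
  obtain c d0 where c: "c > 0" and d0: "d0 > 0"
    and slope: "\<And>x s. \<bar>x\<bar> < d0 \<Longrightarrow> \<bar>s\<bar> < d0 \<Longrightarrow> c \<le> wave_slope k (x, s)"
    using wave_slope_lower_bound [OF k] by blast
  define d where "d = min d0 (min 1 T)"
  have d: "d > 0" "d \<le> d0" "d \<le> 1" "d \<le> T" using d0 T by (auto simp: d_def)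
  have lower: "c\<^sup>2 * d\<^sup>2 / 2 * p \<le> (LINT z:Omega T|lborel. (heat_op (wave k p) z)\<^sup>2)"
    if p: "p \<ge> 1" "p \<ge> 8 * real k / c" for p
  proof -
    define S where "S = {-d<..<d} \<times> {0<..<d / p}"
    have "d / p \<le> T" using p d by (smt (verit) divide_le_eq mult_le_cancel_left1)
    then have S: "S \<subseteq> Omega T" using d by (auto simp: S_def Omega_def)
    have Sm: "S \<in> sets lborel" by (auto simp: S_def intro!: borel_open open_Times)
    have ms: "measure lborel S = 2 * d * (d / p)"
      unfolding S_def using d p by (subst measure_open_rectangle) auto
    have "p * c / 2 \<le> heat_op (wave k p) z" if "z \<in> S" for z
    proof -
      obtain x t where z: "z = (x, t)" by force
      have "\<bar>x\<bar> < d" "0 < t" "t < d / p"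
        using that by (auto simp: S_def z)
      then have "\<bar>p * t\<bar> < d0" "\<bar>x\<bar> < d0" using p d by (auto simp: field_simps)
      then have "p * c \<le> p * wave_slope k (x, p * t)"
        using slope p by (intro mult_left_mono) auto
      moreover have "4 * real k \<le> p * c / 2" using p c by (simp add: field_simps)
      ultimately show ?thesis
        unfolding z heat_op_wave
        using abs_tanh_iter_deriv2_bounded [of k "x + 0.5 + p * t"]
          abs_tanh_iter_deriv2_bounded [of k "x - 0.5 + p * t"] by linarith
    qed
    then have pt: "(p * c / 2)\<^sup>2 \<le> (heat_op (wave k p) z)\<^sup>2" if "z \<in> S" for z
      using that p c by (intro power_mono) auto
    have "S \<subseteq> cbox (-1, 0) (1, T)"
      using S by (auto simp: Omega_def)
    then have fin: "emeasure lborel S < \<infinity>"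
      by (rule le_less_trans [OF emeasure_mono emeasure_lborel_cbox_finite]) simp
    have intS: "set_integrable lborel S (\<lambda>z. (heat_op (wave k p) z)\<^sup>2)"
      by (rule set_integrable_subset [OF set_integrable_heat_op_wave_sq Sm S])
    have "c\<^sup>2 * d\<^sup>2 / 2 * p = (p * c / 2)\<^sup>2 * measure lborel S"
      using p by (simp add: ms power2_eq_square field_simps)
    also have "\<dots> = (LINT z:S|lborel. (p * c / 2)\<^sup>2)"
      using Sm fin by (simp add: set_integral_const)
    also have "\<dots> \<le> (LINT z:S|lborel. (heat_op (wave k p) z)\<^sup>2)"
      using Sm fin intS pt by (intro set_integral_mono) (auto simp: set_integrable_def)
    also have "\<dots> \<le> (LINT z:Omega T|lborel. (heat_op (wave k p) z)\<^sup>2)"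
      using set_integrable_heat_op_wave_sq [of T k p] intS S
      unfolding set_lebesgue_integral_def set_integrable_def
      by (intro integral_mono) (auto simp: indicator_def)
    finally show ?thesis .
  qed
  have "filterlim (\<lambda>p. c\<^sup>2 * d\<^sup>2 / 2 * p) at_top at_top"
    using c d by (intro filterlim_tendsto_pos_mult_at_top [OF tendsto_const _ filterlim_ident]) auto
  then show ?thesis
  proof (rule filterlim_at_top_mono)
    show "\<forall>\<^sub>F p in at_top. c\<^sup>2 * d\<^sup>2 / 2 * p \<le> (LINT z:Omega T|lborel. (heat_op (wave k p) z)\<^sup>2)"
      using eventually_ge_at_top [of 1] eventually_ge_at_top [of "8 * real k / c"]
      by eventually_elim (rule lower)
  qed
qed

text \<open>
  The boundary part of the risk is dropped: the expectation of a nonnegative function is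
  nonnegative, also under the convention that it is \<open>0\<close> for a non-integrable one.
\<close>

lemma risk_wave_at_top:
  assumes "T > 0" "lam > 0" "k > 0"
  shows "filterlim (\<lambda>p. risk lam T h M X (wave k p)) at_top at_top"
proof (rule filterlim_at_top_mono)
  have "1 / measure lborel (Omega T) > 0"
    using assms by (simp add: Omega_def measure_open_rectangle)
  then show "filterlim (\<lambda>p. 1 / measure lborel (Omega T) *
      (LINT z:Omega T|lborel. (heat_op (wave k p) z)\<^sup>2)) at_top at_top"
    using heat_energy_wave_at_top [OF assms(1,3)]
    by (rule filterlim_tendsto_pos_mult_at_top [OF tendsto_const])
  show "\<forall>\<^sub>F p in at_top. 1 / measure lborel (Omega T) *
      (LINT z:Omega T|lborel. (heat_op (wave k p) z)\<^sup>2) \<le> risk lam T h M X (wave k p)"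
    using assms(2) by (simp add: risk_def)
qed

section \<open>The travelling wave as a network\<close>

text \<open>
  Neurons \<open>0\<close> to \<open>3\<close> carry the four terms of the wave in the order of its definition; only the first
  two depend on \<open>x\<close>. The remaining neurons hold arbitrary values that the output weights ignore.
\<close>

definition wave_param :: "nat \<Rightarrow> nat \<Rightarrow> real \<Rightarrow> nn_param" where
  "wave_param H D p =
     (Matrix.mat D 2 (\<lambda>(i, j). if j = 1 then p else of_bool (i < 2)),
      Matrix.vec D (\<lambda>i. if i = 1 then - 0.5 else if i = 3 then 1.5 else 0.5)) #
     replicate (H - 1) (1\<^sub>m D, 0\<^sub>v D) @
     [(Matrix.mat 1 D (\<lambda>(i, j). if j < 4 then (-1) ^ j else 0), 0\<^sub>v 1)]"

lemma wave_param_in_Theta: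
  assumes "H \<ge> 1"
  shows "wave_param H D p \<in> Theta H D"
  unfolding nn_params_def
proof (intro CollectI conjI allI impI)
  show "length (wave_param H D p) = H + 1"
    using assms by (simp add: wave_param_def)
  fix k assume "k \<le> H"
  then consider "k = 0" | "0 < k" "k < H" | "k = H" "k > 0" by linarith
  then have "fst (wave_param H D p ! k) \<in>
        carrier_mat (layer_dim 2 1 H D (k + 1)) (layer_dim 2 1 H D k) \<and>
      snd (wave_param H D p ! k) \<in> carrier_vec (layer_dim 2 1 H D (k + 1))"
    using assms by cases (auto simp: wave_param_def layer_dim_def nth_Cons' nth_append)
  then show "fst (wave_param H D p ! k) \<in>
        carrier_mat (layer_dim 2 1 H D (k + 1)) (layer_dim 2 1 H D k)"
    and "snd (wave_param H D p ! k) \<in> carrier_vec (layer_dim 2 1 H D (k + 1))"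
    by blast+
qed

lemma nn_eval_identity_layers:
  assumes "x \<in> carrier_vec D"
  shows "nn_eval (replicate k (1\<^sub>m D, 0\<^sub>v D) @ [A]) x = affine_layer A (map_vec (tanh ^^ k) x)"
  using assms
proof (induction k arbitrary: x)
  case 0
  have "map_vec (tanh ^^ 0) x = x" by (rule eq_vecI) auto
  then show ?case by (simp only: replicate.simps append.simps nn_eval.simps)
next
  case (Suc k)
  \<comment> \<open>The evaluation applies the activation only if a further layer follows, so the tail has to be
      exhibited as nonempty.\<close>
  obtain B \<theta> where B: "replicate k (1\<^sub>m D, 0\<^sub>v D) @ [A] = B # \<theta>"
    by (cases "replicate k (1\<^sub>m D, 0\<^sub>v D) @ [A]") auto
  have "nn_eval (replicate (Suc k) (1\<^sub>m D, 0\<^sub>v D) @ [A]) x =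
      nn_eval (replicate k (1\<^sub>m D, 0\<^sub>v D) @ [A]) (map_vec tanh x)"
    using Suc.prems by (simp add: B affine_layer_def)
  also have "\<dots> = affine_layer A (map_vec (tanh ^^ k) (map_vec tanh x))"
    using Suc by simp
  also have "map_vec (tanh ^^ k) (map_vec tanh x) = map_vec (tanh ^^ Suc k) x"
    by (auto simp: funpow_swap1)
  finally show ?case .
qed

lemma nn_wave_param:
  assumes "H \<ge> 1" "D \<ge> 4"
  shows "nn (wave_param H D p) = wave H p"
proof (intro ext, clarify)
  fix x t :: real
  define v where "v = Matrix.vec D (\<lambda>i. (if i < 2 then x else 0) + p * t +
      (if i = 1 then - 0.5 else if i = 3 then 1.5 else 0.5))"
  let ?out = "(Matrix.mat 1 D (\<lambda>(i, j). if j < 4 then (-1) ^ j else 0), 0\<^sub>v 1) :: real mat \<times> real Matrix.vec"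
  let ?rest = "replicate (H - 1) (1\<^sub>m D, 0\<^sub>v D) @ [?out]"
  let ?first = "(Matrix.mat D 2 (\<lambda>(i, j). if j = 1 then p else of_bool (i < 2)),
      Matrix.vec D (\<lambda>i. if i = 1 then - 0.5 else if i = 3 then 1.5 else 0.5))"
  have first: "affine_layer ?first (vec_of_list [x, t]) = v"
    by (rule eq_vecI) (auto simp: v_def affine_layer_def scalar_prod_def numeral_2_eq_2)
  obtain B \<theta> where B: "?rest = B # \<theta>" by (cases ?rest) auto
  have "nn_eval (wave_param H D p) (vec_of_list [x, t]) = nn_eval ?rest (map_vec tanh v)"
    unfolding wave_param_def B by (simp only: nn_eval.simps first)
  also have "\<dots> = affine_layer ?out (map_vec (tanh ^^ (H - 1)) (map_vec tanh v))"
    by (rule nn_eval_identity_layers) (simp add: v_def)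
  also have "map_vec (tanh ^^ (H - 1)) (map_vec tanh v) = map_vec (tanh ^^ H) v"
    using assms(1) by (cases H) (auto simp: funpow_swap1)
  finally have "nn (wave_param H D p) (x, t) = 
      (\<Sum>j\<in>{0..<D}. (if j < 4 then (-1) ^ j else 0) * (tanh ^^ H) (vec_index v j))"
    by (simp add: nn_def affine_layer_def scalar_prod_def v_def)
  also have "\<dots> = (\<Sum>j\<in>{0..<4}. (if j < 4 then (-1) ^ j else 0) * (tanh ^^ H) (vec_index v j))"
    using assms(2) by (intro sum.mono_neutral_right) auto
  also have "\<dots> = wave H p (x, t)"
    using assms(2) by (simp add: v_def wave_def numeral_eq_Suc algebra_simps)
  finally show "nn (wave_param H D p) (x, t) = wave H p (x, t)" .
qed

section \<open>Risk consistency\<close>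

lemma emp_risk_nonneg: "lam > 0 \<Longrightarrow> 0 \<le> emp_risk lam h ne nr Xe Xr u"
  unfolding emp_risk_def by (intro add_nonneg_nonneg mult_nonneg_nonneg sum_nonneg) auto

lemma minimizing_seqI:
  assumes "\<And>u. 0 \<le> R u" "\<And>p. \<theta> p \<in> Theta H D" "(\<lambda>p. R (nn (\<theta> p))) \<longlonglongrightarrow> 0"
  shows "minimizing_seq R H D \<theta>"
proof -
  let ?I = "INF \<theta>\<in>Theta H D. R (nn \<theta>)"
  have "?I \<le> R (nn (\<theta> p))" for p
    using assms(1,2) by (intro cINF_lower bdd_belowI2 [of _ 0]) auto
  then have "?I \<le> 0"
    by (intro LIMSEQ_le_const [OF assms(3)]) auto
  moreover have "0 \<le> ?I"
    using assms(1,2) by (intro cINF_greatest) auto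
  ultimately show ?thesis using assms(2,3) by (simp add: minimizing_seq_def)
qed

text \<open>
  The infimum over the networks is embedded in the extended reals from the reals and so cannot equal
  the limit \<open>\<infinity>\<close> of the infinite inner limits.
\<close>

lemma not_risk_consistentI:
  assumes "\<And>ne nr. ne > 0 \<Longrightarrow> nr > 0 \<Longrightarrow> filterlim (\<lambda>p. R (nn (\<theta> p ne nr))) at_top sequentially"
  shows "\<not> risk_consistent R H D \<theta>"
proof
  assume "risk_consistent R H D \<theta>"
  then obtain L :: "nat \<Rightarrow> nat \<Rightarrow> ereal"
    where L: "\<And>ne nr. ne > 0 \<Longrightarrow> nr > 0 \<Longrightarrow> (\<lambda>p. ereal (R (nn (\<theta> p ne nr)))) \<longlonglongrightarrow> L ne nr"
      and lim: "((\<lambda>(ne, nr). L ne nr) \<longlongrightarrow> ereal (INF u\<in>NN H D. R u)) (sequentially \<times>\<^sub>F sequentially)"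
    unfolding risk_consistent_def by blast
  have "L ne nr = \<infinity>" if "ne > 0" "nr > 0" for ne nr
    by (rule LIMSEQ_unique [OF L [OF that]]) (simp add: tendsto_PInfty_eq_at_top assms that)
  moreover have "\<forall>\<^sub>F (ne, nr) in sequentially \<times>\<^sub>F sequentially. ne > (0 :: nat) \<and> nr > (0 :: nat)"
    unfolding eventually_prod_sequentially by (intro exI [of _ 1]) auto
  ultimately have "\<forall>\<^sub>F z in sequentially \<times>\<^sub>F sequentially. (case z of (ne, nr) \<Rightarrow> L ne nr) = \<infinity>"
    by (auto elim!: eventually_mono)
  then have "((\<lambda>_ :: nat \<times> nat. \<infinity>) \<longlongrightarrow> ereal (INF u\<in>NN H D. R u)) (sequentially \<times>\<^sub>F sequentially)"
    using lim by (simp add: tendsto_cong)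
  then show False
    by (simp add: tendsto_const_iff prod_filter_eq_bot)
qed

theorem proposition3p2:
  fixes T lam :: real
    and H D :: nat
    and h :: "real \<times> real \<Rightarrow> real"
    and \<mu>E :: "(real \<times> real) measure"
    and M :: "'w measure"
    and X :: "'w \<Rightarrow> real \<times> real"
  assumes T: "T > 0"
    and H: "H \<ge> 1"
    and lam: "lam > 0"
    and h_lateral: "\<And>t. t \<in> {0..T} \<Longrightarrow> h (-1, t) = 0 \<and> h (1, t) = 0"
    and h_initial: "\<And>x. x \<in> {-1..1} \<Longrightarrow>
      h (x, 0) = (tanh ^^ H) (x + 0.5) - (tanh ^^ H) (x - 0.5)
                 + (tanh ^^ H) 0.5 - (tanh ^^ H) 1.5"
    and \<mu>E: "prob_space \<mu>E" "sets \<mu>E = sets (restrict_space borel (Ebd T))"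
    and X: "prob_space M" "X \<in> measurable M \<mu>E" "distr M \<mu>E X = \<mu>E"
    and D: "D \<ge> 4"
  shows "(\<forall>ne nr (Xe :: nat \<Rightarrow> real \<times> real) (Xr :: nat \<Rightarrow> real \<times> real).
            ne > 0 \<and> nr > 0 \<and> (\<forall>j\<in>{1..ne}. Xe j \<in> Ebd T) \<and> (\<forall>l\<in>{1..nr}. Xr l \<in> Omega T) \<longrightarrow>
            (\<exists>\<theta> :: nat \<Rightarrow> nn_param.
               minimizing_seq (emp_risk lam h ne nr Xe Xr) H D \<theta> \<and>
               (\<lambda>p. emp_risk lam h ne nr Xe Xr (nn (\<theta> p))) \<longlonglongrightarrow> 0 \<and>
               filterlim (\<lambda>p. risk lam T h M X (nn (\<theta> p))) at_top sequentially))
       \<and> (\<forall>(Xe :: nat \<Rightarrow> nat \<Rightarrow> nat \<Rightarrow> real \<times> real) (Xr :: nat \<Rightarrow> nat \<Rightarrow> nat \<Rightarrow> real \<times> real)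
            (\<theta> :: nat \<Rightarrow> nat \<Rightarrow> nat \<Rightarrow> nn_param).
            (\<forall>ne>0. \<forall>nr>0.
               (\<forall>j\<in>{1..ne}. Xe ne nr j \<in> Ebd T) \<and> (\<forall>l\<in>{1..nr}. Xr ne nr l \<in> Omega T) \<and>
               minimizing_seq (emp_risk lam h ne nr (Xe ne nr) (Xr ne nr)) H D (\<lambda>p. \<theta> p ne nr) \<and>
               (\<lambda>p. emp_risk lam h ne nr (Xe ne nr) (Xr ne nr) (nn (\<theta> p ne nr))) \<longlonglongrightarrow> 0 \<and>
               filterlim (\<lambda>p. risk lam T h M X (nn (\<theta> p ne nr))) at_top sequentially) \<longrightarrow>
            \<not> risk_consistent (risk lam T h M X) H D \<theta>)"
proof (intro conjI allI impI)
  fix ne nr :: nat and Xe Xr :: "nat \<Rightarrow> real \<times> real"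
  assume *: "ne > 0 \<and> nr > 0 \<and> (\<forall>j\<in>{1..ne}. Xe j \<in> Ebd T) \<and> (\<forall>l\<in>{1..nr}. Xr l \<in> Omega T)"
  have k: "H > 0" using H by simp
  define \<theta> where "\<theta> p = wave_param H D (real p)" for p
  have \<theta>: "nn (\<theta> p) = wave H (real p)" for p
    unfolding \<theta>_def by (rule nn_wave_param [OF H D])
  have "((\<lambda>p. emp_risk lam h ne nr Xe Xr (wave H p)) \<longlongrightarrow> 0) at_top"
    by (rule emp_risk_wave_tendsto_0 [OF k h_lateral h_initial]) (use * in auto)
  then have emp: "(\<lambda>p. emp_risk lam h ne nr Xe Xr (nn (\<theta> p))) \<longlonglongrightarrow> 0"
    unfolding \<theta> by (rule filterlim_compose [OF _ filterlim_real_sequentially])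
  moreover have "filterlim (\<lambda>p. risk lam T h M X (nn (\<theta> p))) at_top sequentially"
    unfolding \<theta>
    by (rule filterlim_compose [OF risk_wave_at_top [OF T lam k] filterlim_real_sequentially])
  moreover have "minimizing_seq (emp_risk lam h ne nr Xe Xr) H D \<theta>"
    by (rule minimizing_seqI [OF emp_risk_nonneg [OF lam] _ emp])
       (unfold \<theta>_def, rule wave_param_in_Theta [OF H])
  ultimately show "\<exists>\<theta>. minimizing_seq (emp_risk lam h ne nr Xe Xr) H D \<theta> \<and>
      (\<lambda>p. emp_risk lam h ne nr Xe Xr (nn (\<theta> p))) \<longlonglongrightarrow> 0 \<and>
      filterlim (\<lambda>p. risk lam T h M X (nn (\<theta> p))) at_top sequentially"
    by blast
next
  fix Xe Xr :: "nat \<Rightarrow> nat \<Rightarrow> nat \<Rightarrow> real \<times> real" and \<theta> :: "nat \<Rightarrow> nat \<Rightarrow> nat \<Rightarrow> nn_param"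
  assume "\<forall>ne>0. \<forall>nr>0.
      (\<forall>j\<in>{1..ne}. Xe ne nr j \<in> Ebd T) \<and> (\<forall>l\<in>{1..nr}. Xr ne nr l \<in> Omega T) \<and>
      minimizing_seq (emp_risk lam h ne nr (Xe ne nr) (Xr ne nr)) H D (\<lambda>p. \<theta> p ne nr) \<and>
      (\<lambda>p. emp_risk lam h ne nr (Xe ne nr) (Xr ne nr) (nn (\<theta> p ne nr))) \<longlonglongrightarrow> 0 \<and>
      filterlim (\<lambda>p. risk lam T h M X (nn (\<theta> p ne nr))) at_top sequentially"
  then show "\<not> risk_consistent (risk lam T h M X) H D \<theta>"
    by (intro not_risk_consistentI) blast
qed

end
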